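(* Let $\mathcal{A}$ be a compact irreducible family of subadditive, order-preserving, homogeneous maps on $\mathbb{R}^n_{\ge0}$. If $\|\cdot\|_*$ is a monotone extremal norm for $\mathcal{A}$, then the function $$\|x\|_{**} := \lim_{m\to\infty}\ \sup_{f\in\mathcal{A}^m}\|f(|x|)\|_*$$ is a Barabanov norm for $\mathcal{A}$.
   Context: $\mathbb{R}^n_{\ge0}$ is the standard cone of vectors with nonnegative entries in $\mathbb{R}^n$, and $x\ge y$ means $x-y\in\mathbb{R}^n_{\ge0}$. A map on $\mathbb{R}^n_{\ge0}$ means a map $f:\mathbb{R}^n_{\ge0}\to\mathbb{R}^n_{\ge0}$. Such a map is order-preserving if $f(x)\ge f(y)$ whenever $x\ge y$, homogeneous if $f(cx)=cf(x)$ for all $c>0$ and all $x$, and subadditive if $f(x+y)\le f(x)+f(y)$ for all $x,y$. (Order-preserving, homogeneous, subadditive maps on $\mathbb{R}^n_{\ge0}$ are automatically continuous.) For $x\in\mathbb{R}^n$, $|x|$ is the vector obtained by taking the absolute value of each entry. A norm on $\mathbb{R}^n$ is monotone if $\|x\|\le\|y\|$ whenever $0\le x\le y$. A family of continuous homogeneous maps on $\mathbb{R}^n_{\ge0}$ is compact if, restricted to $\Omega_1=\{x\in\mathbb{R}^n_{\ge0} : \|x\|\le1\}$, it is compact in the Banach space $C(\Omega_1,\mathbb{R}^n)$ of continuous functions with the supremum norm. For a norm $\|\cdot\|$ on $\mathbb{R}^n$ and a homogeneous map $f$ on $\mathbb{R}^n_{\ge0}$, $\|f\|:=\sup\{\|f(x)\|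 : x\in\mathbb{R}^n_{\ge0},\ \|x\|=1\}$. For $m\ge1$, $\mathcal{A}^m:=\{f_m\circ\cdots\circ f_1 : f_i\in\mathcal{A}\}$. The joint spectral radius is $\hat r(\mathcal{A}):=\inf_{m>0}\sup_{f\in\mathcal{A}^m}\|f\|^{1/m}=\lim_{m\to\infty}\sup_{f\in\mathcal{A}^m}\|f\|^{1/m}$ (independent of the choice of norm on $\mathbb{R}^n$). $\mathcal{A}$ is irreducible if there is no non-trivial closed face of $\mathbb{R}^n_{\ge0}$ (that is, no face other than $\{0\}$ and $\mathbb{R}^n_{\ge0}$ itself) that is an invariant set for all $f\in\mathcal{A}$. An extremal norm for $\mathcal{A}$ is a norm $\|\cdot\|_*$ on $\mathbb{R}^n$ such that $\|f(x)\|_*\le\hat r(\mathcal{A})\|x\|_*$ for all $x\in\mathbb{R}^n_{\ge0}$ and $f\in\mathcal{A}$. An extremal norm $\|\cdot\|_*$ for $\mathcal{A}$ is called a Barabanov norm if for every $x\in\mathbb{R}^n_{\ge0}$ there exists $f\in\mathcal{A}$ such that $\|f(x)\|_*=\hat r(\mathcal{A})\|x\|_*$.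
   Formalization: The limit formula is false unless the joint spectral radius r is 1 (n=1, A={x->2x} gives infinity); it is proved for r=1, and for general r with the supremum divided by r^m; the family is taken nonempty, and the case n=1, A={0} (r=0), where the limit is 0, is excluded. *)

theory Defs
  imports "HOL-Analysis.Analysis"
begin

text \<open>
  The order and the absolute value on \<open>real ^ 'n\<close> are the componentwise ones of the library.
  A self-map of the cone is represented by a total function \<open>real ^ 'n \<Rightarrow> real ^ 'n\<close>;
  no definition below depends on its values outside the cone.
\<close>

definition nonneg_cone :: "(real ^ 'n) set" where
  "nonneg_cone = {x. 0 \<le> x}"

definition map_on_cone :: "(real ^ 'n \<Rightarrow> real ^ 'n) \<Rightarrow> bool" where
  "map_on_cone f \<longleftrightarrow> f \<in> nonneg_cone \<rightarrow> nonneg_cone"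

definition order_preserving_map :: "(real ^ 'n \<Rightarrow> real ^ 'n) \<Rightarrow> bool" where
  "order_preserving_map f \<longleftrightarrow> (\<forall>x\<in>nonneg_cone. \<forall>y\<in>nonneg_cone. y \<le> x \<longrightarrow> f y \<le> f x)"

definition homogeneous_map :: "(real ^ 'n \<Rightarrow> real ^ 'n) \<Rightarrow> bool" where
  "homogeneous_map f \<longleftrightarrow> (\<forall>c>0. \<forall>x\<in>nonneg_cone. f (c *\<^sub>R x) = c *\<^sub>R f x)"

definition subadditive_map :: "(real ^ 'n \<Rightarrow> real ^ 'n) \<Rightarrow> bool" where
  "subadditive_map f \<longleftrightarrow> (\<forall>x\<in>nonneg_cone. \<forall>y\<in>nonneg_cone. f (x + y) \<le> f x + f y)"

definition is_norm :: "(real ^ 'n \<Rightarrow> real) \<Rightarrow> bool" where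
  "is_norm N \<longleftrightarrow>
     (\<forall>x. 0 \<le> N x) \<and> (\<forall>x. N x = 0 \<longleftrightarrow> x = 0) \<and>
     (\<forall>c x. N (c *\<^sub>R x) = \<bar>c\<bar> * N x) \<and> (\<forall>x y. N (x + y) \<le> N x + N y)"

definition monotone_norm :: "(real ^ 'n \<Rightarrow> real) \<Rightarrow> bool" where
  "monotone_norm N \<longleftrightarrow> is_norm N \<and> (\<forall>x y. 0 \<le> x \<and> x \<le> y \<longrightarrow> N x \<le> N y)"

text \<open>
  The background norm on \<open>real ^ 'n\<close>, used for the set \<open>\<Omega>\<^sub>1\<close>, for the supremum metric and for the
  operator norm, is the Euclidean one; compactness of a family of homogeneous maps and the joint
  spectral radius do not depend on this choice.
\<close>

definition Omega1 :: "(real ^ 'n) set" where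
  "Omega1 = {x \<in> nonneg_cone. norm x \<le> 1}"

text \<open>
  \<open>cfunspace\<close> is the space of bounded continuous functions with the supremum metric. Its elements
  are extensional, hence the restriction. Compactness includes that all the restrictions are
  members of the space, that is, continuous.
\<close>

definition compact_family :: "(real ^ 'n \<Rightarrow> real ^ 'n) set \<Rightarrow> bool" where
  "compact_family \<A> \<longleftrightarrow>
     compactin (mtopology_of (cfunspace (top_of_set Omega1) euclidean_metric))
       ((\<lambda>f. restrict f Omega1) ` \<A>)"

definition cone_opnorm :: "(real ^ 'n \<Rightarrow> real ^ 'n) \<Rightarrow> real" where
  "cone_opnorm f = (SUP x\<in>{x \<in> nonneg_cone. norm x = 1}. norm (f x))"

primrec family_power :: "('a \<Rightarrow> 'a) set \<Rightarrow> nat \<Rightarrow> ('a \<Rightarrow> 'a) set" where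
  "family_power \<A> 0 = {id}"
| "family_power \<A> (Suc m) = {f \<circ> g | f g. f \<in> \<A> \<and> g \<in> family_power \<A> m}"

text \<open>
  Real-valued: for a nonempty compact family of homogeneous maps all the suprema involved are
  suprema of nonempty sets that are bounded above.
\<close>

definition joint_spectral_radius :: "(real ^ 'n \<Rightarrow> real ^ 'n) set \<Rightarrow> real" where
  "joint_spectral_radius \<A> =
     (INF m\<in>{1..}. SUP f\<in>family_power \<A> m. root m (cone_opnorm f))"

text \<open>The library counts the empty set as a face; a face of a cone is nonempty.\<close>

definition irreducible_family :: "(real ^ 'n \<Rightarrow> real ^ 'n) set \<Rightarrow> bool" where
  "irreducible_family \<A> \<longleftrightarrow>
     \<not> (\<exists>F. F face_of nonneg_cone \<and> closed F \<and> F \<noteq> {} \<and> F \<noteq> {0} \<and> F \<noteq> nonneg_cone \<and> (\<forall>f\<in>\<A>. f ` F \<subseteq> F))"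

definition extremal_norm :: "(real ^ 'n \<Rightarrow> real ^ 'n) set \<Rightarrow> (real ^ 'n \<Rightarrow> real) \<Rightarrow> bool" where
  "extremal_norm \<A> N \<longleftrightarrow>
     is_norm N \<and> (\<forall>f\<in>\<A>. \<forall>x\<in>nonneg_cone. N (f x) \<le> joint_spectral_radius \<A> * N x)"

definition barabanov_norm :: "(real ^ 'n \<Rightarrow> real ^ 'n) set \<Rightarrow> (real ^ 'n \<Rightarrow> real) \<Rightarrow> bool" where
  "barabanov_norm \<A> N \<longleftrightarrow>
     extremal_norm \<A> N \<and> (\<forall>x\<in>nonneg_cone. \<exists>f\<in>\<A>. N (f x) = joint_spectral_radius \<A> * N x)"

end

theory Submission
  imports Defs
begin

text \<open>
  Write \<open>r\<close> for the joint spectral radius and \<open>v\<^sub>m x\<close> for the supremum of \<open>N (f \<bar>x\<bar>) / r ^ m\<close> over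
  the products \<open>f\<close> of \<open>m\<close> members of the family; in the file this is \<open>growth m x\<close>. Subadditivity and
  monotonicity of the products and of \<open>N\<close> make every \<open>v\<^sub>m\<close> a seminorm that is monotone on the cone.
  Applying one more map on the outside and using extremality shows that \<open>v\<^sub>m\<close> decreases in \<open>m\<close>, so the
  limit \<open>v\<close> (\<open>limit_growth\<close>) exists and is again a monotone seminorm. Splitting off the innermost
  map instead gives \<open>v\<^sub>m (f x) \<le> r * v\<^sub>m\<^sub>+\<^sub>1 x\<close>, hence \<open>v (f x) \<le> r * v x\<close>.

  Two things are left. First, \<open>v\<close> must be definite. The zeros of a monotone seminorm in the cone form
  a closed face (\<open>monotone_seminorm_kernel_face\<close>), and that of \<open>v\<close> is invariant; irreducibility
  leaves only \<open>{0}\<close> and the whole cone. In the latter case \<open>v\<^sub>m\<close> tends to zero at the all-ones vector,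
  which dominates the unit ball of the cone; so for a single large \<open>m\<close> all products of length \<open>m\<close>
  have norm below \<open>r ^ m\<close>, and the joint spectral radius would be less than itself
  (\<open>limit_growth_vanishes_imp_rate_not_sharp\<close>).

  Second, equality must be attained. Since \<open>r * v\<^sub>m\<^sub>+\<^sub>1 x\<close> is the supremum of \<open>v\<^sub>m (f x)\<close> over the
  family, one can choose \<open>f\<^sub>m\<close> with \<open>v\<^sub>m (f\<^sub>m x)\<close> almost as large as \<open>r * v x\<close>. The orbit of \<open>x\<close> is compact
  (\<open>compact_orbit\<close>), so \<open>f\<^sub>m x\<close> accumulates at some \<open>f x\<close>. As \<open>v\<^sub>m\<close> decreases in \<open>m\<close> and each \<open>v\<^sub>k\<close> is
  continuous, \<open>v\<^sub>k (f x) \<ge> r * v x\<close> for every \<open>k\<close>, and \<open>k\<close> tends to infinity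
  (\<open>limit_growth_attained\<close>).

  Division by \<open>r\<close> is justified because extremality forces \<open>r \<ge> 0\<close>, and \<open>r = 0\<close> would make all maps
  vanish on the cone, so that in dimension at least two every coordinate hyperplane would cut out a
  non-trivial invariant face; in dimension one \<open>r \<noteq> 0\<close> is a hypothesis.
\<close>

section \<open>Monotone seminorms and faces of the cone\<close>

definition monotone_seminorm :: "(real ^ 'n \<Rightarrow> real) \<Rightarrow> bool" where
  "monotone_seminorm p \<longleftrightarrow>
     (\<forall>c x. p (c *\<^sub>R x) = \<bar>c\<bar> * p x) \<and> (\<forall>x y. p (x + y) \<le> p x + p y) \<and>
     (\<forall>x y. 0 \<le> x \<and> x \<le> y \<longrightarrow> p x \<le> p y)"

lemma monotone_seminormI:
  assumes "\<And>c x. p (c *\<^sub>R x) = \<bar>c\<bar> * p x" "\<And>x y. p (x + y) \<le> p x + p y"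
    and "\<And>x y. 0 \<le> x \<Longrightarrow> x \<le> y \<Longrightarrow> p x \<le> p y"
  shows "monotone_seminorm p"
  using assms by (auto simp: monotone_seminorm_def)

lemma monotone_seminormD:
  assumes "monotone_seminorm p"
  shows "p (c *\<^sub>R x) = \<bar>c\<bar> * p x" "p (x + y) \<le> p x + p y" "0 \<le> x \<Longrightarrow> x \<le> y \<Longrightarrow> p x \<le> p y"
  using assms by (auto simp: monotone_seminorm_def)

lemma monotone_norm_imp_seminorm: "monotone_norm N \<Longrightarrow> monotone_seminorm N"
  by (auto simp: monotone_norm_def is_norm_def monotone_seminorm_def)

lemma monotone_seminorm_zero: "monotone_seminorm p \<Longrightarrow> p 0 = 0"
  using monotone_seminormD(1)[of p 0 0] by simp

lemma monotone_seminorm_nonneg: "monotone_seminorm p \<Longrightarrow> 0 \<le> p x"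
  using monotone_seminormD(1)[of p "-1" x] monotone_seminormD(2)[of p x "-x"]
    monotone_seminorm_zero[of p] by simp

text \<open>
  A seminorm on a finite-dimensional space is continuous because it is convex. This gives
  the continuity of the growth seminorms and of their limit without explicit bounds.
\<close>

lemma monotone_seminorm_continuous:
  assumes "monotone_seminorm p"
  shows "continuous_on UNIV p"
proof -
  have "convex_on UNIV p"
  proof (rule convex_onI)
    fix t :: real and x y assume "0 < t" "t < 1"
    then show "p ((1 - t) *\<^sub>R x + t *\<^sub>R y) \<le> (1 - t) * p x + t * p y"
      using monotone_seminormD(2)[OF assms, of "(1 - t) *\<^sub>R x" "t *\<^sub>R y"]
        monotone_seminormD(1)[OF assms] by simp
  qed simp
  then show ?thesis
    by (intro convex_on_continuous) auto
qed

lemma vec_abs_add_le: "\<bar>x + y\<bar> \<le> \<bar>x\<bar> + \<bar>y :: real ^ 'n\<bar>"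
  by (simp add: less_eq_vec_def abs_vec_def abs_triangle_ineq)

lemma vec_abs_scaleR: "\<bar>c *\<^sub>R x\<bar> = \<bar>c\<bar> *\<^sub>R \<bar>x :: real ^ 'n\<bar>"
  by (simp add: vec_eq_iff abs_vec_def abs_mult)

lemma vec_abs_nonneg: "0 \<le> \<bar>x :: real ^ 'n\<bar>"
  by (simp add: less_eq_vec_def abs_vec_def)

lemma vec_abs_of_nonneg: "0 \<le> x \<Longrightarrow> \<bar>x :: real ^ 'n\<bar> = x"
  by (simp add: less_eq_vec_def abs_vec_def vec_eq_iff)

lemma vec_abs_eq_0: "\<bar>x :: real ^ 'n\<bar> = 0 \<longleftrightarrow> x = 0"
  by (simp add: abs_vec_def vec_eq_iff)

lemma nonneg_coneD: "x \<in> nonneg_cone \<Longrightarrow> 0 \<le> x"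
  by (simp add: nonneg_cone_def)

lemma zero_in_nonneg_cone: "0 \<in> nonneg_cone"
  by (simp add: nonneg_cone_def)

lemma nonneg_cone_add: "x \<in> nonneg_cone \<Longrightarrow> y \<in> nonneg_cone \<Longrightarrow> x + y \<in> nonneg_cone"
  unfolding nonneg_cone_def less_eq_vec_def by auto

lemma nonneg_cone_scaleR: "0 \<le> c \<Longrightarrow> x \<in> nonneg_cone \<Longrightarrow> c *\<^sub>R x \<in> nonneg_cone"
  unfolding nonneg_cone_def less_eq_vec_def by auto

lemma abs_in_nonneg_cone: "\<bar>x\<bar> \<in> nonneg_cone"
  by (simp add: nonneg_cone_def vec_abs_nonneg)

lemma closed_nonneg_cone: "closed (nonneg_cone :: (real ^ 'n) set)"
proof -
  have "nonneg_cone = (\<Inter>i. {x :: real ^ 'n. 0 \<le> x $ i})"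
    by (auto simp: nonneg_cone_def less_eq_vec_def)
  moreover have "closed (\<Inter>i. {x :: real ^ 'n. 0 \<le> x $ i})"
    by (intro closed_INT ballI closed_Collect_le continuous_intros)
  ultimately show ?thesis by simp
qed

text \<open>
  If \<open>x = (1 - u) a + u b\<close> lies in the zero set, then \<open>0 \<le> (1 - u) a \<le> x\<close>, and monotonicity pushes
  the value zero down to \<open>a\<close>; by symmetry also to \<open>b\<close>.
\<close>

lemma monotone_seminorm_kernel_face:
  fixes p :: "real ^ 'n \<Rightarrow> real"
  assumes p: "monotone_seminorm p"
  defines "F \<equiv> {x \<in> nonneg_cone. p x = 0}"
  shows "F face_of nonneg_cone" "closed F" "0 \<in> F"
proof -
  show "0 \<in> F"
    by (simp add: F_def zero_in_nonneg_cone monotone_seminorm_zero[OF p])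
  have "closed {x. p x = 0}"
    by (intro closed_Collect_eq monotone_seminorm_continuous p continuous_intros)
  then show "closed F"
    using closed_nonneg_cone by (auto simp: F_def Collect_conj_eq intro!: closed_Int)
  show "F face_of nonneg_cone"
    unfolding face_of_def
  proof (intro conjI ballI impI)
    show "F \<subseteq> nonneg_cone" by (auto simp: F_def)
    show "convex F"
    proof (rule convexI)
      fix x y :: "real ^ 'n" and u v :: real
      assume xy: "x \<in> F" "y \<in> F" and uv: "0 \<le> u" "0 \<le> v" "u + v = 1"
      have "p (u *\<^sub>R x + v *\<^sub>R y) \<le> 0"
        using monotone_seminormD(2)[OF p, of "u *\<^sub>R x" "v *\<^sub>R y"] xy
        by (simp add: monotone_seminormD(1)[OF p] F_def)
      then show "u *\<^sub>R x + v *\<^sub>R y \<in> F"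
        using monotone_seminorm_nonneg[OF p] xy uv
        by (auto simp: F_def intro!: nonneg_cone_add nonneg_cone_scaleR antisym)
    qed
    have endpoint: "a \<in> F" if "a \<in> nonneg_cone" "b \<in> nonneg_cone"
      "(1 - u) *\<^sub>R a + u *\<^sub>R b \<in> F" "0 < u" "u < 1" for a b u
    proof -
      have "(1 - u) *\<^sub>R a \<in> nonneg_cone" "u *\<^sub>R b \<in> nonneg_cone"
        using that by (auto intro: nonneg_cone_scaleR)
      then have "p ((1 - u) *\<^sub>R a) \<le> p ((1 - u) *\<^sub>R a + u *\<^sub>R b)"
        by (intro monotone_seminormD(3)[OF p]) (auto simp: nonneg_cone_def)
      also have "\<dots> = 0" using that by (simp add: F_def)
      finally have "(1 - u) * p a \<le> 0"
        using that by (simp add: monotone_seminormD(1)[OF p])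
      then have "p a \<le> 0" using that by (simp add: mult_le_0_iff)
      then show ?thesis
        using monotone_seminorm_nonneg[OF p, of a] that by (simp add: F_def)
    qed
    fix a b x assume ab: "a \<in> nonneg_cone" "b \<in> nonneg_cone" and x: "x \<in> F" "x \<in> open_segment a b"
    then obtain u where u: "0 < u" "u < 1" "x = (1 - u) *\<^sub>R a + u *\<^sub>R b"
      by (auto simp: in_segment)
    show "a \<in> F" using endpoint[of a b u] u ab x by simp
    show "b \<in> F" using endpoint[of b a "1 - u"] u ab x by (simp add: add.commute)
  qed
qed

lemma irreducible_seminorm_kernel:
  fixes p :: "real ^ 'n \<Rightarrow> real"
  assumes "irreducible_family \<A>" "monotone_seminorm p"
    and maps: "\<And>f. f \<in> \<A> \<Longrightarrow> map_on_cone f"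
    and inv: "\<And>f x. f \<in> \<A> \<Longrightarrow> x \<in> nonneg_cone \<Longrightarrow> p x = 0 \<Longrightarrow> p (f x) = 0"
  shows "{x \<in> nonneg_cone. p x = 0} = {0} \<or> {x \<in> nonneg_cone. p x = 0} = nonneg_cone"
proof -
  let ?F = "{x \<in> nonneg_cone. p x = 0}"
  have "f ` ?F \<subseteq> ?F" if "f \<in> \<A>" for f
    using maps[OF that] inv[OF that] by (auto simp: map_on_cone_def)
  moreover note monotone_seminorm_kernel_face[OF assms(2)]
  ultimately show ?thesis
    using assms(1) unfolding irreducible_family_def by (metis (lifting) empty_iff)
qed

text \<open>
  One half of the equivalence of norms, obtained from the minimum of \<open>N\<close> on the unit sphere. It lets
  growth measured in \<open>N\<close> control the joint spectral radius, which is measured in the Euclidean norm.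
\<close>

lemma norm_dominates_Euclidean:
  fixes N :: "real ^ 'n \<Rightarrow> real"
  assumes "monotone_norm N"
  obtains C where "0 < C" "\<And>x. norm x \<le> C * N x"
proof -
  have N: "monotone_seminorm N" and pos: "x \<noteq> 0 \<Longrightarrow> 0 < N x" for x
    using assms monotone_norm_imp_seminorm
    by (auto simp: monotone_norm_def is_norm_def less_le)
  have "sphere 0 1 \<noteq> ({} :: (real ^ 'n) set)" by simp
  then obtain z :: "real ^ 'n" where z: "norm z = 1" "\<And>x. norm x = 1 \<Longrightarrow> N z \<le> N x"
    using continuous_attains_inf[of "sphere 0 1 :: (real ^ 'n) set" N]
      continuous_on_subset[OF monotone_seminorm_continuous[OF N]] by auto
  have "0 < N z" using z(1) by (intro pos) auto
  have "norm x \<le> 1 / N z * N x" for x :: "real ^ 'n"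
  proof (cases "x = 0")
    case False
    then have "N z \<le> N (inverse (norm x) *\<^sub>R x)" by (intro z(2)) simp
    then show ?thesis
      using False \<open>0 < N z\<close> by (simp add: monotone_seminormD(1)[OF N] field_simps)
  qed (simp add: monotone_seminorm_zero[OF N])
  then show ?thesis using that[of "1 / N z"] \<open>0 < N z\<close> by simp
qed

section \<open>Compactness of orbits\<close>

text \<open>
  Evaluation at a point of \<open>Omega1\<close> is Lipschitz for the supremum metric, so it maps the compact
  family to a compact set. Homogeneity carries this to an arbitrary point of the cone.
\<close>

lemma compact_orbit:
  fixes \<A> :: "(real ^ 'n \<Rightarrow> real ^ 'n) set"
  assumes "compact_family \<A>" and hom: "\<And>f. f \<in> \<A> \<Longrightarrow> homogeneous_map f"
    and x: "x \<in> nonneg_cone"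
  shows "compact ((\<lambda>f. f x) ` \<A>)"
proof -
  let ?M = "cfunspace (top_of_set Omega1) euclidean_metric :: (real ^ 'n \<Rightarrow> real ^ 'n) metric"
  \<comment> \<open>Adding 1 keeps the factor positive when \<open>x = 0\<close>.\<close>
  define c where "c = norm x + 1"
  define u where "u = inverse c *\<^sub>R x"
  have c: "0 < c" by (simp add: c_def add_nonneg_pos)
  have u: "u \<in> Omega1" "u \<in> nonneg_cone" and xu: "x = c *\<^sub>R u"
    using c x by (auto simp: u_def Omega1_def c_def intro!: nonneg_cone_scaleR)
       (simp add: field_simps)
  have "Lipschitz_continuous_map ?M euclidean_metric (\<lambda>f. f u)"
    unfolding Lipschitz_continuous_map_def
  proof (intro conjI exI ballI)
    fix f g assume fg: "f \<in> mspace ?M" "g \<in> mspace ?M"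
    show "mdist euclidean_metric (f u) (g u) \<le> 1 * mdist ?M f g"
      by (rule mdist_cfunspace_imp_mdist_le[OF fg]) (use u in simp_all)
  qed auto
  then have "continuous_map (mtopology_of ?M) euclidean (\<lambda>f. f u)"
    using Lipschitz_continuous_imp_continuous_map by fastforce
  then have "compactin euclidean ((\<lambda>f. f u) ` (\<lambda>f. restrict f Omega1) ` \<A>)"
    using assms(1) image_compactin unfolding compact_family_def by blast
  then have "compact ((\<lambda>f. f u) ` \<A>)"
    using u by (simp add: image_image)
  then have "compact ((*\<^sub>R) c ` (\<lambda>f. f u) ` \<A>)"
    by (rule compact_scaling)
  moreover have "(*\<^sub>R) c ` (\<lambda>f. f u) ` \<A> = (\<lambda>f. f x) ` \<A>"
    using hom c u by (auto simp: image_image xu homogeneous_map_def intro!: image_cong)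
  ultimately show ?thesis by simp
qed

section \<open>Products of maps\<close>

lemma family_power_nonempty: "\<A> \<noteq> {} \<Longrightarrow> family_power \<A> m \<noteq> {}"
  by (induction m) auto

text \<open>
  The powers are built by composing on the outside, which suits the monotonicity of the growth in \<open>m\<close>;
  comparing the growth at \<open>f x\<close> with that at \<open>x\<close> needs the innermost factor instead.
\<close>

lemma family_power_Suc_right:
  "family_power \<A> (Suc m) = {g \<circ> f | g f. g \<in> family_power \<A> m \<and> f \<in> \<A>}"
proof (induction m)
  case (Suc m)
  have "family_power \<A> (Suc (Suc m)) = {h \<circ> g | h g. h \<in> \<A> \<and> g \<in> family_power \<A> (Suc m)}"
    by simp
  also have "\<dots> = {h \<circ> (g \<circ> f) | h g f. h \<in> \<A> \<and> g \<in> family_power \<A> m \<and> f \<in> \<A>}"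
    unfolding Suc.IH by blast
  also have "\<dots> = {g \<circ> f | g f. g \<in> family_power \<A> (Suc m) \<and> f \<in> \<A>}"
    by (simp only: family_power.simps mem_Collect_eq) (metis (lifting) o_assoc)
  finally show ?case .
qed auto

definition cone_sublinear :: "(real ^ 'n \<Rightarrow> real ^ 'n) \<Rightarrow> bool" where
  "cone_sublinear f \<longleftrightarrow>
     map_on_cone f \<and> subadditive_map f \<and> order_preserving_map f \<and> homogeneous_map f"

lemma cone_sublinearD:
  assumes "cone_sublinear f" "x \<in> nonneg_cone"
  shows "f x \<in> nonneg_cone"
    and "y \<in> nonneg_cone \<Longrightarrow> f (x + y) \<le> f x + f y"
    and "y \<in> nonneg_cone \<Longrightarrow> x \<le> y \<Longrightarrow> f x \<le> f y"
    and "0 < c \<Longrightarrow> f (c *\<^sub>R x) = c *\<^sub>R f x"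
  using assms
  by (auto simp: cone_sublinear_def map_on_cone_def subadditive_map_def order_preserving_map_def
      homogeneous_map_def)

lemma cone_sublinear_comp:
  assumes f: "cone_sublinear f" and g: "cone_sublinear g"
  shows "cone_sublinear (f \<circ> g)"
proof -
  have "f (g (x + y)) \<le> f (g x) + f (g y)" if "x \<in> nonneg_cone" "y \<in> nonneg_cone" for x y
  proof -
    have "f (g (x + y)) \<le> f (g x + g y)"
      using that by (intro cone_sublinearD[OF f] cone_sublinearD[OF g] nonneg_cone_add)
    also have "\<dots> \<le> f (g x) + f (g y)"
      using that by (intro cone_sublinearD[OF f] cone_sublinearD[OF g])
    finally show ?thesis .
  qed
  then show ?thesis
    using cone_sublinearD[OF f] cone_sublinearD[OF g]
    by (auto simp: cone_sublinear_def map_on_cone_def subadditive_map_def order_preserving_map_def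
      homogeneous_map_def)
qed

lemma cone_sublinear_family_power:
  assumes "\<And>f. f \<in> \<A> \<Longrightarrow> cone_sublinear f" "f \<in> family_power \<A> m"
  shows "cone_sublinear f"
  using assms(2)
proof (induction m arbitrary: f)
  case 0
  then show ?case
    by (simp add: cone_sublinear_def map_on_cone_def subadditive_map_def order_preserving_map_def
      homogeneous_map_def)
qed (auto intro: cone_sublinear_comp assms(1))

section \<open>The limit seminorm\<close>

text \<open>
  The rate \<open>r\<close> is a parameter, not the joint spectral radius itself, so that a vanishing limit can be
  shown to force the joint spectral radius strictly below \<open>r\<close>.
\<close>

locale contracted_family =
  fixes \<A> :: "(real ^ 'n \<Rightarrow> real ^ 'n) set" and N :: "real ^ 'n \<Rightarrow> real" and r :: real
  assumes nonempty: "\<A> \<noteq> {}"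
    and sublinear: "f \<in> \<A> \<Longrightarrow> cone_sublinear f"
    and monotone_norm: "monotone_norm N"
    and rate_pos: "0 < r"
    and contraction: "f \<in> \<A> \<Longrightarrow> x \<in> nonneg_cone \<Longrightarrow> N (f x) \<le> r * N x"
begin

definition growth :: "nat \<Rightarrow> real ^ 'n \<Rightarrow> real" where
  "growth m x = (SUP f\<in>family_power \<A> m. N (f \<bar>x\<bar>)) / r ^ m"

definition limit_growth :: "real ^ 'n \<Rightarrow> real" where
  "limit_growth x = lim (\<lambda>m. growth m x)"

lemma seminorm_N: "monotone_seminorm N"
  using monotone_norm by (rule monotone_norm_imp_seminorm)

lemma power_sublinear: "f \<in> family_power \<A> m \<Longrightarrow> cone_sublinear f"
  using cone_sublinear_family_power[of \<A>] sublinear by blast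

lemma power_contraction:
  "f \<in> family_power \<A> m \<Longrightarrow> x \<in> nonneg_cone \<Longrightarrow> N (f x) \<le> r ^ m * N x"
proof (induction m arbitrary: f)
  case (Suc m)
  then obtain g h where gh: "f = g \<circ> h" "g \<in> \<A>" "h \<in> family_power \<A> m" by auto
  have "N (f x) \<le> r * N (h x)"
    using contraction[OF gh(2) cone_sublinearD(1)[OF power_sublinear[OF gh(3)] Suc.prems(2)]] gh(1)
    by simp
  also have "\<dots> \<le> r * (r ^ m * N x)"
    using Suc.IH[OF gh(3) Suc.prems(2)] rate_pos by simp
  finally show ?case by (simp add: mult.assoc)
qed simp

text \<open>
  This and \<open>growth_least\<close> are the two halves of the universal property of the supremum. The
  contraction bound makes the supremum one of a bounded set.
\<close>

lemma growth_upper: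
  assumes "f \<in> family_power \<A> m"
  shows "N (f \<bar>x\<bar>) \<le> r ^ m * growth m x"
proof -
  have "N (f \<bar>x\<bar>) \<le> (SUP f\<in>family_power \<A> m. N (f \<bar>x\<bar>))"
    using power_contraction[OF _ abs_in_nonneg_cone, of _ m x] assms
    by (intro cSUP_upper) (auto intro!: bdd_aboveI)
  then show ?thesis using rate_pos by (simp add: growth_def)
qed

lemma growth_upper_cone:
  "f \<in> family_power \<A> m \<Longrightarrow> x \<in> nonneg_cone \<Longrightarrow> N (f x) \<le> r ^ m * growth m x"
  using growth_upper[of f m x] by (simp add: vec_abs_of_nonneg nonneg_coneD)

lemma growth_least:
  assumes "\<And>f. f \<in> family_power \<A> m \<Longrightarrow> N (f \<bar>x\<bar>) \<le> r ^ m * c"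
  shows "growth m x \<le> c"
proof -
  have "(SUP f\<in>family_power \<A> m. N (f \<bar>x\<bar>)) \<le> r ^ m * c"
    using assms family_power_nonempty[OF nonempty] by (intro cSUP_least) auto
  then show ?thesis using rate_pos by (simp add: growth_def field_simps)
qed

lemma growth_least_cone:
  assumes "x \<in> nonneg_cone" "\<And>f. f \<in> family_power \<A> m \<Longrightarrow> N (f x) \<le> r ^ m * c"
  shows "growth m x \<le> c"
  using assms growth_least[of m x c] by (simp add: vec_abs_of_nonneg nonneg_coneD)

lemma growth_nonneg: "0 \<le> growth m x"
proof -
  obtain f where "f \<in> family_power \<A> m" using family_power_nonempty[OF nonempty] by blast
  then have "0 \<le> r ^ m * growth m x"
    using growth_upper monotone_seminorm_nonneg[OF seminorm_N] order_trans by blast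
  then show ?thesis using rate_pos by (metis mult_le_cancel_left_pos mult_zero_right zero_less_power)
qed

lemma growth_mono:
  assumes "0 \<le> x" "x \<le> y"
  shows "growth m x \<le> growth m y"
proof -
  have xy: "x \<in> nonneg_cone" "y \<in> nonneg_cone"
    using assms by (auto simp: nonneg_cone_def)
  show ?thesis
  proof (rule growth_least_cone[OF xy(1)])
    fix f assume f: "f \<in> family_power \<A> m"
    have "N (f x) \<le> N (f y)"
      using cone_sublinearD[OF power_sublinear[OF f] xy(1)] xy assms
      by (intro monotone_seminormD(3)[OF seminorm_N]) (auto simp: nonneg_coneD)
    then show "N (f x) \<le> r ^ m * growth m y"
      using growth_upper_cone[OF f xy(2)] by simp
  qed
qed

lemma growth_abs: "growth m \<bar>x\<bar> = growth m x"
  by (simp add: growth_def vec_abs_of_nonneg vec_abs_nonneg)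

lemma growth_triangle: "growth m (x + y) \<le> growth m x + growth m y"
proof -
  have "growth m (x + y) \<le> growth m (\<bar>x\<bar> + \<bar>y\<bar>)"
    using growth_mono[of "\<bar>x + y\<bar>" "\<bar>x\<bar> + \<bar>y\<bar>" m]
    by (simp add: growth_abs vec_abs_nonneg vec_abs_add_le)
  also have "\<dots> \<le> growth m x + growth m y"
  proof (rule growth_least_cone)
    fix f assume f: "f \<in> family_power \<A> m"
    have "N (f (\<bar>x\<bar> + \<bar>y\<bar>)) \<le> N (f \<bar>x\<bar> + f \<bar>y\<bar>)"
      using cone_sublinearD[OF power_sublinear[OF f]]
      by (intro monotone_seminormD(3)[OF seminorm_N])
         (auto intro!: nonneg_coneD nonneg_cone_add abs_in_nonneg_cone)
    also have "\<dots> \<le> N (f \<bar>x\<bar>) + N (f \<bar>y\<bar>)"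
      by (rule monotone_seminormD(2)[OF seminorm_N])
    also have "\<dots> \<le> r ^ m * (growth m x + growth m y)"
      using growth_upper[OF f, of x] growth_upper[OF f, of y] by (simp add: distrib_left)
    finally show "N (f (\<bar>x\<bar> + \<bar>y\<bar>)) \<le> r ^ m * (growth m x + growth m y)" .
  qed (intro nonneg_cone_add abs_in_nonneg_cone)
  finally show ?thesis .
qed

lemma growth_0: "growth m 0 = 0"
proof -
  have "growth m 0 \<le> 0"
    using power_contraction[OF _ zero_in_nonneg_cone, of _ m] monotone_seminorm_zero[OF seminorm_N]
    by (intro growth_least_cone zero_in_nonneg_cone) auto
  then show ?thesis using growth_nonneg[of m 0] by simp
qed

text \<open>
  Homogeneity of the maps concerns positive factors only, so \<open>c = 0\<close> is separate; for the other
  factors the inequality for \<open>inverse c\<close> at \<open>c x\<close> is the converse of that for \<open>c\<close> at \<open>x\<close>.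
\<close>

lemma growth_scaleR: "growth m (c *\<^sub>R x) = \<bar>c\<bar> * growth m x"
proof -
  have le: "growth m (c *\<^sub>R x) \<le> \<bar>c\<bar> * growth m x" if "c \<noteq> 0" for c x
  proof (rule growth_least)
    fix f assume f: "f \<in> family_power \<A> m"
    have "N (f \<bar>c *\<^sub>R x\<bar>) = \<bar>c\<bar> * N (f \<bar>x\<bar>)"
      using cone_sublinearD(4)[OF power_sublinear[OF f] abs_in_nonneg_cone, of "\<bar>c\<bar>" x] that
      by (simp add: vec_abs_scaleR monotone_seminormD(1)[OF seminorm_N])
    then show "N (f \<bar>c *\<^sub>R x\<bar>) \<le> r ^ m * (\<bar>c\<bar> * growth m x)"
      using growth_upper[OF f, of x] 
        mult_left_mono[of "N (f \<bar>x\<bar>)" "r ^ m * growth m x" "\<bar>c\<bar>"]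
      by (simp add: ac_simps)
  qed
  show ?thesis
  proof (cases "c = 0")
    case False
    then have "growth m x \<le> \<bar>inverse c\<bar> * growth m (c *\<^sub>R x)"
      using le[of "inverse c" "c *\<^sub>R x"] by simp
    then show ?thesis using le[of c x] False by (simp add: field_simps)
  qed (simp add: growth_0)
qed

lemma growth_seminorm: "monotone_seminorm (growth m)"
  by (intro monotone_seminormI growth_scaleR growth_triangle growth_mono)

text \<open>
  The outermost of \<open>m + 1\<close> factors multiplies \<open>N\<close> by at most \<open>r\<close>, which the denominator absorbs.
\<close>

lemma growth_decreasing: "decseq (\<lambda>m. growth m x)"
proof (rule decseq_SucI, rule growth_least)
  fix m f assume "f \<in> family_power \<A> (Suc m)"
  then obtain g h where gh: "f = g \<circ> h" "g \<in> \<A>" "h \<in> family_power \<A> m" by auto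
  have "N (f \<bar>x\<bar>) \<le> r * N (h \<bar>x\<bar>)"
    using contraction[OF gh(2) cone_sublinearD(1)[OF power_sublinear[OF gh(3)] abs_in_nonneg_cone]]
      gh(1) by simp
  also have "\<dots> \<le> r * (r ^ m * growth m x)"
    using growth_upper[OF gh(3)] rate_pos by simp
  finally show "N (f \<bar>x\<bar>) \<le> r ^ Suc m * growth m x" by (simp add: mult.assoc)
qed

lemma growth_step:
  assumes "f \<in> \<A>" "x \<in> nonneg_cone"
  shows "growth m (f x) \<le> r * growth (Suc m) x"
proof (rule growth_least_cone)
  show "f x \<in> nonneg_cone" using cone_sublinearD(1)[OF sublinear] assms by blast
  fix g assume "g \<in> family_power \<A> m"
  then have "g \<circ> f \<in> family_power \<A> (Suc m)"
    using assms by (auto simp: family_power_Suc_right simp del: family_power.simps)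
  from growth_upper_cone[OF this assms(2)]
  show "N (g (f x)) \<le> r ^ m * (r * growth (Suc m) x)" by (simp add: ac_simps)
qed

text \<open>
  Converse to \<open>growth_step\<close>: the supremum over products of length \<open>m + 1\<close> is an iterated one, taken
  over the innermost factor last, so some choice of that factor comes within \<open>e\<close>.
\<close>

lemma growth_step_sharp:
  assumes x: "x \<in> nonneg_cone" and "e > 0"
  shows "\<exists>f\<in>\<A>. r * growth (Suc m) x - e \<le> growth m (f x)"
proof (rule ccontr)
  assume "\<not> ?thesis"
  then have small: "growth m (f x) \<le> r * growth (Suc m) x - e" if "f \<in> \<A>" for f
    using that by force
  have "growth (Suc m) x \<le> growth (Suc m) x - e / r"
  proof (rule growth_least_cone[OF x])
    fix h assume "h \<in> family_power \<A> (Suc m)"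
    then obtain g f where gf: "h = g \<circ> f" "g \<in> family_power \<A> m" "f \<in> \<A>"
      by (auto simp: family_power_Suc_right simp del: family_power.simps)
    have "N (h x) \<le> r ^ m * growth m (f x)"
      using growth_upper_cone[OF gf(2) cone_sublinearD(1)[OF sublinear[OF gf(3)] x]] gf(1) by simp
    also have "\<dots> \<le> r ^ m * (r * growth (Suc m) x - e)"
      using small[OF gf(3)] rate_pos by simp
    also have "\<dots> = r ^ Suc m * (growth (Suc m) x - e / r)"
      using rate_pos by (simp add: field_simps)
    finally show "N (h x) \<le> r ^ Suc m * (growth (Suc m) x - e / r)" .
  qed
  then show False using \<open>e > 0\<close> rate_pos by (simp add: field_simps)
qed

lemma growth_limit: "(\<lambda>m. growth m x) \<longlonglongrightarrow> limit_growth x"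
  using decseq_convergent[OF growth_decreasing] growth_nonneg
  unfolding limit_growth_def by (metis convergentI convergent_LIMSEQ_iff)

lemma limit_growth_le: "limit_growth x \<le> growth m x"
  using decseq_ge[OF growth_decreasing growth_limit] .

lemma limit_growth_seminorm: "monotone_seminorm limit_growth"
proof (rule monotone_seminormI)
  show "limit_growth (c *\<^sub>R x) = \<bar>c\<bar> * limit_growth x" for c x
    using tendsto_mult_left[OF growth_limit[of x], of "\<bar>c\<bar>"] growth_limit[of "c *\<^sub>R x"]
    by (intro LIMSEQ_unique[OF growth_limit]) (simp add: growth_scaleR)
  show "limit_growth (x + y) \<le> limit_growth x + limit_growth y" for x y
    by (rule LIMSEQ_le[OF growth_limit tendsto_add[OF growth_limit growth_limit]])
       (simp add: growth_triangle)
  show "limit_growth x \<le> limit_growth y" if "0 \<le> x" "x \<le> y" for x y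
    by (rule LIMSEQ_le[OF growth_limit growth_limit]) (use growth_mono that in blast)
qed

lemma limit_growth_contraction:
  assumes "f \<in> \<A>" "x \<in> nonneg_cone"
  shows "limit_growth (f x) \<le> r * limit_growth x"
  by (rule LIMSEQ_le[OF growth_limit tendsto_mult_left[OF LIMSEQ_Suc[OF growth_limit]]])
     (use growth_step assms in blast)

text \<open>
  The maps that nearly attain the growth after \<open>m\<close> more steps vary with \<open>m\<close>. A limit point of their
  values at \<open>x\<close> works for all steps at once, since near-attainment at step \<open>m\<close> implies it at every
  earlier step \<open>k\<close>, where it survives the limit by continuity.
\<close>

lemma limit_growth_attained:
  assumes "compact_family \<A>" and x: "x \<in> nonneg_cone"
  shows "\<exists>f\<in>\<A>. limit_growth (f x) = r * limit_growth x"
proof -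
  have "\<exists>f\<in>\<A>. r * limit_growth x - inverse (real (Suc m)) \<le> growth m (f x)" for m
  proof -
    obtain f where "f \<in> \<A>" "r * growth (Suc m) x - inverse (real (Suc m)) \<le> growth m (f x)"
      using growth_step_sharp[OF x, of "inverse (real (Suc m))" m] by auto
    moreover have "r * limit_growth x \<le> r * growth (Suc m) x"
      using limit_growth_le rate_pos by simp
    ultimately show ?thesis by (intro bexI[of _ f]) linarith+
  qed
  then obtain f where f: "\<And>m. f m \<in> \<A>"
    "\<And>m. r * limit_growth x - inverse (real (Suc m)) \<le> growth m (f m x)"
    by metis
  have "seq_compact ((\<lambda>f. f x) ` \<A>)"
    using compact_orbit[OF assms(1) _ x] sublinear
    by (auto simp: cone_sublinear_def compact_eq_seq_compact_metric)
  then obtain g \<sigma> where g: "g \<in> \<A>" and \<sigma>: "strict_mono (\<sigma> :: nat \<Rightarrow> nat)"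
    and lim: "(\<lambda>j. f (\<sigma> j) x) \<longlonglongrightarrow> g x"
    using f(1) unfolding seq_compact_def by (auto dest!: spec[of _ "\<lambda>m. f m x"] simp: o_def)
  have "r * limit_growth x \<le> growth k (g x)" for k
  proof (rule LIMSEQ_le)
    have "(\<lambda>m. r * limit_growth x - inverse (real (Suc m))) \<longlonglongrightarrow> r * limit_growth x - 0"
      by (intro tendsto_intros LIMSEQ_inverse_real_of_nat)
    then show "(\<lambda>j. r * limit_growth x - inverse (real (Suc (\<sigma> j)))) \<longlonglongrightarrow> r * limit_growth x"
      using LIMSEQ_subseq_LIMSEQ[OF _ \<sigma>] by (fastforce simp: o_def)
    show "(\<lambda>j. growth k (f (\<sigma> j) x)) \<longlonglongrightarrow> growth k (g x)"
      using continuous_on_tendsto_compose[OF monotone_seminorm_continuous[OF growth_seminorm] lim]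
      by auto
    have "r * limit_growth x - inverse (real (Suc (\<sigma> j))) \<le> growth k (f (\<sigma> j) x)" if "k \<le> j" for j
    proof -
      have "k \<le> \<sigma> j" using that seq_suble[OF \<sigma>, of j] by simp
      then have "growth (\<sigma> j) (f (\<sigma> j) x) \<le> growth k (f (\<sigma> j) x)"
        using growth_decreasing by (auto simp: decseq_def)
      then show ?thesis using f(2)[of "\<sigma> j"] by linarith
    qed
    then show "\<exists>n. \<forall>j\<ge>n. r * limit_growth x - inverse (real (Suc (\<sigma> j))) \<le> growth k (f (\<sigma> j) x)"
      by blast
  qed
  then have "r * limit_growth x \<le> limit_growth (g x)"
    by (intro LIMSEQ_le_const[OF growth_limit]) auto
  then show ?thesis
    using limit_growth_contraction[OF g x] g by (intro bexI[of _ g]) auto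
qed

text \<open>
  The all-ones vector dominates every unit vector of the cone. So if the growth tends to zero there, it
  does so uniformly on the unit sphere of the cone, and one power \<open>m\<close> in the infimum that defines the
  joint spectral radius already gives a value below \<open>r\<close>. The infimum and the suprema are taken in
  the reals, hence the boundedness checks.
\<close>

lemma limit_growth_vanishes_imp_rate_not_sharp:
  assumes vanish: "limit_growth 1 = 0"
  shows "joint_spectral_radius \<A> < r"
proof -
  obtain C where C: "0 < C" "\<And>x. norm x \<le> C * N x"
    using norm_dominates_Euclidean[OF monotone_norm] by blast
  have one: "(1 :: real ^ 'n) \<in> nonneg_cone" by (simp add: nonneg_cone_def less_eq_vec_def)
  let ?S = "{x :: real ^ 'n. x \<in> nonneg_cone \<and> norm x = 1}"
  obtain i :: 'n where True by blast
  have S: "axis i 1 \<in> ?S"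
    by (simp add: nonneg_cone_def less_eq_vec_def axis_def norm_axis_1[unfolded axis_def])
  have pointwise: "norm (f x) \<le> C * (r ^ m * growth m 1)"
    if f: "f \<in> family_power \<A> m" and x: "x \<in> ?S" for f m x
  proof -
    have "x \<le> 1"
      using x component_le_norm_cart[of x] by (auto simp: less_eq_vec_def abs_le_iff)
    have "norm (f x) \<le> C * N (f x)" by (rule C(2))
    also have "\<dots> \<le> C * (r ^ m * growth m x)"
      using growth_upper_cone[OF f] x C(1) by simp
    also have "\<dots> \<le> C * (r ^ m * growth m 1)"
      using growth_mono[OF nonneg_coneD \<open>x \<le> 1\<close>] x C(1) rate_pos by simp
    finally show ?thesis .
  qed
  have opnorm_le: "cone_opnorm f \<le> C * (r ^ m * growth m 1)" if "f \<in> family_power \<A> m" for f m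
    unfolding cone_opnorm_def using pointwise[OF that] S by (intro cSUP_least) auto
  have opnorm_nonneg: "0 \<le> cone_opnorm f" if "f \<in> family_power \<A> m" for f m
  proof -
    have "norm (f (axis i 1)) \<le> cone_opnorm f"
      unfolding cone_opnorm_def using pointwise[OF that] S
      by (intro cSUP_upper) (auto intro!: bdd_aboveI)
    then show ?thesis using norm_ge_zero order_trans by blast
  qed
  define s where "s m = (SUP f\<in>family_power \<A> m. root m (cone_opnorm f))" for m
  have s_le: "s m \<le> root m (C * (r ^ m * growth m 1))" if "1 \<le> m" for m
    unfolding s_def using opnorm_le that family_power_nonempty[OF nonempty]
    by (intro cSUP_least) auto
  have s_nonneg: "0 \<le> s m" if "1 \<le> m" for m
  proof -
    obtain f where f: "f \<in> family_power \<A> m" using family_power_nonempty[OF nonempty] by blast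
    have "root m (cone_opnorm f) \<le> s m"
      unfolding s_def
      by (rule cSUP_upper[OF f])
         (use opnorm_le that in \<open>auto intro!: bdd_aboveI[of _ "root m (C * (r ^ m * growth m 1))"]\<close>)
    then show ?thesis
      using opnorm_nonneg[OF f] that by (meson order_trans real_root_ge_zero)
  qed
  have "\<forall>\<^sub>F m in sequentially. C * growth m 1 < 1"
    using tendsto_mult_left[OF growth_limit[of 1], of C] vanish
    by (intro order_tendstoD) auto
  then have "\<forall>\<^sub>F m in sequentially. C * growth m 1 < 1 \<and> 1 \<le> m"
    using eventually_ge_at_top by (rule eventually_conj)
  then obtain m where m: "C * growth m 1 < 1" "1 \<le> m"
    using eventually_happens' sequentially_bot by blast
  have "joint_spectral_radius \<A> \<le> s m"
    unfolding joint_spectral_radius_def s_def[symmetric]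
    using m s_nonneg by (intro cINF_lower) (auto intro!: bdd_belowI)
  also have "\<dots> \<le> root m (C * (r ^ m * growth m 1))" by (rule s_le[OF m(2)])
  also have "\<dots> = r * root m (C * growth m 1)"
    using m(2) rate_pos by (simp add: real_root_mult real_root_power_cancel)
  also have "\<dots> < r * 1"
    using m rate_pos by (intro mult_strict_left_mono) auto
  finally show ?thesis by simp
qed

text \<open>
  Sharpness of the rate keeps the all-ones vector out of the zero set of the limit, so irreducibility
  reduces this invariant closed face to \<open>{0}\<close>.
\<close>

theorem limit_growth_barabanov:
  assumes sharp: "r = joint_spectral_radius \<A>"
    and "compact_family \<A>" "irreducible_family \<A>"
  shows "barabanov_norm \<A> limit_growth"
proof -
  let ?F = "{x \<in> nonneg_cone. limit_growth x = 0}"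
  have "limit_growth (f x) = 0" if "f \<in> \<A>" "x \<in> nonneg_cone" "limit_growth x = 0" for f x
    using limit_growth_contraction[OF that(1,2)] that(3)
      monotone_seminorm_nonneg[OF limit_growth_seminorm, of "f x"] by simp
  then have "?F = {0} \<or> ?F = nonneg_cone"
    using assms(3) sublinear
    by (intro irreducible_seminorm_kernel limit_growth_seminorm) (auto simp: cone_sublinear_def)
  moreover have "1 \<notin> ?F"
    using limit_growth_vanishes_imp_rate_not_sharp sharp by auto
  moreover have "(1 :: real ^ 'n) \<in> nonneg_cone" by (simp add: nonneg_cone_def less_eq_vec_def)
  ultimately have F: "?F = {0}" by blast
  have abs: "limit_growth \<bar>x\<bar> = limit_growth x" for x
    by (simp add: limit_growth_def growth_abs)
  have "limit_growth x = 0 \<longleftrightarrow> x = 0" for x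
  proof
    assume "limit_growth x = 0"
    then have "\<bar>x\<bar> \<in> ?F" by (simp add: abs abs_in_nonneg_cone)
    then show "x = 0" using F by (simp add: vec_abs_eq_0)
  qed (simp add: monotone_seminorm_zero[OF limit_growth_seminorm])
  then have "is_norm limit_growth"
    using limit_growth_seminorm monotone_seminorm_nonneg[OF limit_growth_seminorm]
    by (auto simp: is_norm_def monotone_seminorm_def)
  then show ?thesis
    using limit_growth_contraction limit_growth_attained[OF assms(2)] sharp
    by (auto simp: barabanov_norm_def extremal_norm_def)
qed

end

section \<open>Positivity of the joint spectral radius\<close>

text \<open>
  A negative rate would give \<open>N (f 1) < 0\<close>.
\<close>

lemma joint_spectral_radius_nonneg_of_extremal:
  fixes \<A> :: "(real ^ 'n \<Rightarrow> real ^ 'n) set"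
  assumes "\<A> \<noteq> {}" "extremal_norm \<A> N"
  shows "0 \<le> joint_spectral_radius \<A>"
proof -
  obtain f where f: "f \<in> \<A>" using assms(1) by blast
  have one: "(1 :: real ^ 'n) \<in> nonneg_cone" by (simp add: nonneg_cone_def less_eq_vec_def)
  have "N 1 \<noteq> 0" "0 \<le> N 1" "0 \<le> N (f 1)" using assms(2)
    by (auto simp: extremal_norm_def is_norm_def)
  moreover have "N (f 1) \<le> joint_spectral_radius \<A> * N 1"
    using assms(2) f one by (auto simp: extremal_norm_def)
  ultimately have "0 \<le> joint_spectral_radius \<A> * N 1" "0 < N 1" by linarith+
  then show ?thesis by (simp add: zero_le_mult_iff)
qed

lemma coordinate_seminorm: "monotone_seminorm (\<lambda>x :: real ^ 'n. \<bar>x $ i\<bar>)"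
  by (intro monotone_seminormI) (auto simp: abs_mult abs_triangle_ineq less_eq_vec_def
    intro!: order_trans[OF _ abs_ge_self])

text \<open>
  At rate zero every map vanishes on the cone, so every face is invariant. In dimension at least two
  the face \<open>x $ i = 0\<close> is neither \<open>{0}\<close> nor the whole cone.
\<close>

lemma joint_spectral_radius_nonzero_of_irreducible:
  fixes \<A> :: "(real ^ 'n \<Rightarrow> real ^ 'n) set"
  assumes "CARD('n) \<ge> 2" "irreducible_family \<A>" "extremal_norm \<A> N"
    and maps: "\<And>f. f \<in> \<A> \<Longrightarrow> map_on_cone f"
  shows "joint_spectral_radius \<A> \<noteq> 0"
proof
  assume "joint_spectral_radius \<A> = 0"
  then have null: "f x = 0" if "f \<in> \<A>" "x \<in> nonneg_cone" for f x
  proof -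
    have "N (f x) \<le> 0" "0 \<le> N (f x)" "N (f x) = 0 \<longleftrightarrow> f x = 0"
      using assms(3) that \<open>joint_spectral_radius \<A> = 0\<close>
      by (auto simp: extremal_norm_def is_norm_def)
    then show ?thesis by simp
  qed
  obtain i j :: 'n where "i \<noteq> j"
    using assms(1) by (metis card_2_iff' card_le_Suc0_iff_eq finite UNIV_I not_less_eq_eq numeral_2_eq_2)
  let ?F = "{x :: real ^ 'n. x \<in> nonneg_cone \<and> \<bar>x $ i\<bar> = 0}"
  have "?F = {0} \<or> ?F = nonneg_cone"
    by (rule irreducible_seminorm_kernel[OF assms(2) coordinate_seminorm maps]) (auto simp: null)
  moreover have "axis j 1 \<in> ?F" "axis i 1 \<in> nonneg_cone - ?F"
    using \<open>i \<noteq> j\<close> by (auto simp: nonneg_cone_def less_eq_vec_def axis_def)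
  moreover have "axis j 1 \<noteq> (0 :: real ^ 'n)" by (simp add: axis_eq_0_iff)
  ultimately show False by blast
qed

section \<open>The Barabanov norm\<close>

theorem theorem5p2:
  fixes \<A> :: "(real ^ 'n \<Rightarrow> real ^ 'n) set" and N :: "real ^ 'n \<Rightarrow> real"
  assumes "\<A> \<noteq> {}"
    and "\<And>f. f \<in> \<A> \<Longrightarrow>
           map_on_cone f \<and> subadditive_map f \<and> order_preserving_map f \<and> homogeneous_map f"
    and "compact_family \<A>"
    and "irreducible_family \<A>"
    and "CARD('n) \<ge> 2 \<or> joint_spectral_radius \<A> \<noteq> 0"
    and "extremal_norm \<A> N"
    and "monotone_norm N"
  shows "(joint_spectral_radius \<A> = 1 \<longrightarrow>
           (\<forall>x. convergent (\<lambda>m. SUP f\<in>family_power \<A> m. N (f \<bar>x\<bar>))) \<and>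
           barabanov_norm \<A> (\<lambda>x. lim (\<lambda>m. SUP f\<in>family_power \<A> m. N (f \<bar>x\<bar>)))) \<and>
         (\<forall>x. convergent
            (\<lambda>m. (SUP f\<in>family_power \<A> m. N (f \<bar>x\<bar>)) / joint_spectral_radius \<A> ^ m)) \<and>
         barabanov_norm \<A>
           (\<lambda>x. lim (\<lambda>m. (SUP f\<in>family_power \<A> m. N (f \<bar>x\<bar>)) / joint_spectral_radius \<A> ^ m))"
proof -
  let ?r = "joint_spectral_radius \<A>"
  have "?r \<noteq> 0"
    using joint_spectral_radius_nonzero_of_irreducible[of \<A> N] assms by blast
  then have "0 < ?r"
    using joint_spectral_radius_nonneg_of_extremal assms by (simp add: less_le)
  then interpret contracted_family \<A> N ?r
    using assms by unfold_locales (auto simp: cone_sublinear_def extremal_norm_def)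
  have "convergent (\<lambda>m. (SUP f\<in>family_power \<A> m. N (f \<bar>x\<bar>)) / ?r ^ m)" for x
    using growth_limit[of x] unfolding growth_def by (rule convergentI)
  moreover have "barabanov_norm \<A>
      (\<lambda>x. lim (\<lambda>m. (SUP f\<in>family_power \<A> m. N (f \<bar>x\<bar>)) / ?r ^ m))"
    using limit_growth_barabanov[OF refl assms(3,4)]
    unfolding limit_growth_def[abs_def] growth_def .
  ultimately show ?thesis by auto
qed

end
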